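(* Let $\rho,\omega,\tau>0$, let $S\in\mathbb{R}^{n\times n}$ be symmetric positive definite, and let $f:\mathbb{R}^n\to\mathbb{R}$, $c:\mathbb{R}^n\to\mathbb{R}^m$ be bounded and twice Lipschitz-continuously differentiable. Let $\{\mathbf{x}_k\}_{k\in\mathbb{N}_0}\subset\Omega$ be the iterates of the PPD-IPM algorithm (described in the context), with step directions $\mathbf{v}_k$ and step sizes $\alpha_k$. Suppose that the choice $\widetilde H_k=H_k$ is suitable (i.e. $H_k+\frac1\omega\nabla c(\mathbf{x}_k)\nabla c(\mathbf{x}_k)^{T}$ is positive semi-definite) and is made. Then: (i) if $\alpha_k=1$, then $\|\nabla\phi(\mathbf{x}_k+\alpha_k\mathbf{v}_k)\|_2=\mathcal{O}(\|\mathbf{v}_k\|_2^2)$; (ii) the line-search returns $\alpha_k$ sufficiently close to $1$ for all $k$ sufficiently large; (iii) for $k\in\mathbb{N}$ sufficiently large (greater than some finite number) there is second order convergence of $\|\nabla\phi(\mathbf{x}_k)\|_2\to0$.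
   Context: $\mathbf{1}\in\mathbb{R}^n$ is the vector of ones; $\log$ acts componentwise. $\nabla c(\mathbf{x})\in\mathbb{R}^{n\times m}$ is the transposed Jacobian of $c$. $\Omega:=\{\xi\in\mathbb{R}^n:\|\xi\|_\infty<1\}$. The penalty-barrier function on $\Omega$ is $$\phi(\mathbf{x}):=f(\mathbf{x})+\frac{\rho}{2}\mathbf{x}^{T}S\mathbf{x}+\frac{1}{2\omega}\|c(\mathbf{x})\|_2^2-\tau\,\mathbf{1}^{T}\big(\log(\mathbf{1}+\mathbf{x})+\log(\mathbf{1}-\mathbf{x})\big).$$ The Lagrangian is $\mathcal{L}(\mathbf{x},\lambda):=f(\mathbf{x})-\lambda^{T}c(\mathbf{x})$. PPD-IPM algorithm (considered without its stopping test $\|\nabla\phi(\mathbf{x}_k)\|_2\le\mathrm{tol}$, so that it yields an infinite sequence), started from an arbitrary $\mathbf{x}_0\in\Omega$. Given $\mathbf{x}_k\in\Omega$: 1. Set $\lambda_k:=-\frac1\omega c(\mathbf{x}_k)$ and $H_k:=\nabla^2_{\mathbf{x}\mathbf{x}}\mathcal{L}(\mathbf{x}_k,\lambda_k)$. 2. Choose an approximation $\widetilde H_k\approx H_k$ such that $\widetilde M_k:=\widetilde H_k+\frac1\omega\nabla c(\mathbf{x}_k)\nabla c(\mathbf{x}_k)^{T}$ is symmetric positive semi-definite. 3. Set $Q_k:=\widetilde H_k+\rho S$, $A_k:=\nabla c(\mathbf{x}_k)^{T}$, $\mathbf{c}_k:=\nabla f(\mathbf{x}_k)-\widetilde H_k\mathbf{x}_k$,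 $\mathbf{b}_k:=-c(\mathbf{x}_k)+A_k\mathbf{x}_k$, and $$q_k(\mathbf{x}):=\tfrac12\mathbf{x}^{T}Q_k\mathbf{x}+\mathbf{c}_k^{T}\mathbf{x}+\frac{1}{2\omega}\|A_k\mathbf{x}-\mathbf{b}_k\|_2^2-\tau\,\mathbf{1}^{T}\big(\log(\mathbf{1}+\mathbf{x})+\log(\mathbf{1}-\mathbf{x})\big).$$ (This function is strictly convex, $\nabla q_k(\mathbf{x}_k)=\nabla\phi(\mathbf{x}_k)$, and $\nabla^2q_k(\mathbf{x}_k)=\nabla^2\phi(\mathbf{x}_k)$ if $\widetilde H_k=H_k$.) 4. Let $\hat{\mathbf{x}}_k$ be the minimizer of $q_k$ over $\overline\Omega$ (it lies in $\Omega$), and $\mathbf{v}_k:=\hat{\mathbf{x}}_k-\mathbf{x}_k$. 5. Let $\alpha_k:=\operatorname{argmin}_{\alpha\in\mathbb{R}^+}\phi(\mathbf{x}_k+\alpha\mathbf{v}_k)$ (line-search, along the line inside $\Omega$), and set $\mathbf{x}_{k+1}:=\mathbf{x}_k+\alpha_k\mathbf{v}_k$. Convergence of the iterates to a stationary point of $\phi$ from every initial guess is a separate global convergence result for this algorithm, and it is used here. It is also used that at a local minimizer $\mathbf{x}^\star$ of $\phi$ one has $\nabla\phi(\mathbf{x}^\star)=\mathbf{0}$ and $\nabla^2\phi(\mathbf{x}^\star)$ positive definite. Sufficient conditions for $\widetilde H_k=H_k$ to be suitable: $H_k$ is positive semi-definite; or the projection of $H_k$ onto the orthogonal complement of the column space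 of $\nabla c(\mathbf{x}_k)$ is positive semi-definite and $\omega>0$ is suitably small. *)

theory Defs
  imports "HOL-Analysis.Analysis"
begin

definition grad :: "(real^'n \<Rightarrow> real) \<Rightarrow> real^'n \<Rightarrow> real^'n" where
  "grad g x = (\<chi> i. frechet_derivative g (at x) (axis i 1))"

definition hessian :: "(real^'n \<Rightarrow> real) \<Rightarrow> real^'n \<Rightarrow> real^'n^'n" where
  "hessian g x = jacobian (grad g) (at x)"

definition trans_jacobian :: "(real^'n \<Rightarrow> real^'m) \<Rightarrow> real^'n \<Rightarrow> real^'m^'n" where
  "trans_jacobian c x = transpose (jacobian c (at x))"

definition sym_pos_semidef :: "real^'n^'n \<Rightarrow> bool" where
  "sym_pos_semidef A \<longleftrightarrow> transpose A = A \<and> (\<forall>x. 0 \<le> x \<bullet> (A *v x))"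

definition sym_pos_def :: "real^'n^'n \<Rightarrow> bool" where
  "sym_pos_def A \<longleftrightarrow> transpose A = A \<and> (\<forall>x. x \<noteq> 0 \<longrightarrow> 0 < x \<bullet> (A *v x))"

(* The second derivative is taken as a bounded-linear-map-valued function and is globally
   Lipschitz.  For a bounded function this already makes the function and its first
   derivative globally Lipschitz as well. *)
definition twice_lipschitz_differentiable ::
    "('a::euclidean_space \<Rightarrow> 'b::euclidean_space) \<Rightarrow> bool" where
  "twice_lipschitz_differentiable g \<longleftrightarrow>
     (\<exists>(g' :: 'a \<Rightarrow> 'a \<Rightarrow>\<^sub>L 'b) (g'' :: 'a \<Rightarrow> 'a \<Rightarrow>\<^sub>L ('a \<Rightarrow>\<^sub>L 'b)) L.
        (\<forall>x. (g has_derivative blinfun_apply (g' x)) (at x)) \<and>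
        (\<forall>x. (g' has_derivative blinfun_apply (g'' x)) (at x)) \<and>
        L-lipschitz_on UNIV g'')"

definition Omega :: "(real^'n) set" where
  "Omega = {\<xi>. infnorm \<xi> < 1}"

(* Meaningful on Omega only.  On the boundary the mathematical value of the negated
   barrier is +infinity, whereas the total function ln still returns real values there; hence
   all minimizations below range over Omega. *)
definition log_barrier :: "real^'n \<Rightarrow> real" where
  "log_barrier x = (\<Sum>i\<in>UNIV. ln (1 + x $ i) + ln (1 - x $ i))"

definition penalty_barrier ::
    "real \<Rightarrow> real \<Rightarrow> real \<Rightarrow> real^'n^'n \<Rightarrow> (real^'n \<Rightarrow> real) \<Rightarrow> (real^'n \<Rightarrow> real^'m) \<Rightarrow> real^'n \<Rightarrow> real"
  where
  "penalty_barrier \<rho> \<omega> \<tau> S f c x =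
     f x + \<rho> / 2 * (x \<bullet> (S *v x)) + 1 / (2 * \<omega>) * (norm (c x))\<^sup>2 - \<tau> * log_barrier x"

definition lagrangian ::
    "(real^'n \<Rightarrow> real) \<Rightarrow> (real^'n \<Rightarrow> real^'m) \<Rightarrow> real^'n \<Rightarrow> real^'m \<Rightarrow> real" where
  "lagrangian f c x l = f x - l \<bullet> c x"

definition multiplier :: "real \<Rightarrow> (real^'n \<Rightarrow> real^'m) \<Rightarrow> real^'n \<Rightarrow> real^'m" where
  "multiplier \<omega> c x = - (1 / \<omega>) *\<^sub>R c x"

(* H_k as a function of the iterate: the multiplier stays frozen at y while the Lagrangian
   is differentiated. *)
definition lagrangian_hessian ::
    "real \<Rightarrow> (real^'n \<Rightarrow> real) \<Rightarrow> (real^'n \<Rightarrow> real^'m) \<Rightarrow> real^'n \<Rightarrow> real^'n^'n" where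
  "lagrangian_hessian \<omega> f c y = hessian (\<lambda>x. lagrangian f c x (multiplier \<omega> c y)) y"

definition suitable ::
    "real \<Rightarrow> (real^'n \<Rightarrow> real^'m) \<Rightarrow> real^'n \<Rightarrow> real^'n^'n \<Rightarrow> bool" where
  "suitable \<omega> c y Ht \<longleftrightarrow>
     sym_pos_semidef (Ht + (1 / \<omega>) *\<^sub>R (trans_jacobian c y ** transpose (trans_jacobian c y)))"

(* The function q_k, with y the current iterate and Ht the approximate Hessian. *)
definition subproblem ::
    "real \<Rightarrow> real \<Rightarrow> real \<Rightarrow> real^'n^'n \<Rightarrow> (real^'n \<Rightarrow> real) \<Rightarrow> (real^'n \<Rightarrow> real^'m)
       \<Rightarrow> real^'n \<Rightarrow> real^'n^'n \<Rightarrow> real^'n \<Rightarrow> real"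
  where
  "subproblem \<rho> \<omega> \<tau> S f c y Ht x =
     (let Q = Ht + \<rho> *\<^sub>R S;
          A = transpose (trans_jacobian c y);
          d = grad f y - Ht *v y;
          b = - c y + A *v y
      in 1 / 2 * (x \<bullet> (Q *v x)) + d \<bullet> x + 1 / (2 * \<omega>) * (norm (A *v x - b))\<^sup>2
           - \<tau> * log_barrier x)"

(* Ht, x, v, \<alpha> are the sequences of approximate Hessians, iterates, directions and step sizes
   of a run without stopping test.  Any global minimizer is admitted in the line-search, which
   ranges over the part of the ray that lies in Omega.  If v k = 0 the current iterate is
   stationary and every step size is a minimizer. *)
definition ppd_ipm ::
    "real \<Rightarrow> real \<Rightarrow> real \<Rightarrow> real^'n^'n \<Rightarrow> (real^'n \<Rightarrow> real) \<Rightarrow> (real^'n \<Rightarrow> real^'m)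
       \<Rightarrow> (nat \<Rightarrow> real^'n^'n) \<Rightarrow> (nat \<Rightarrow> real^'n) \<Rightarrow> (nat \<Rightarrow> real^'n) \<Rightarrow> (nat \<Rightarrow> real) \<Rightarrow> bool"
  where
  "ppd_ipm \<rho> \<omega> \<tau> S f c Ht x v \<alpha> \<longleftrightarrow>
     x 0 \<in> Omega \<and>
     (\<forall>k. suitable \<omega> c (x k) (Ht k) \<and>
          (\<exists>xh. is_arg_min (subproblem \<rho> \<omega> \<tau> S f c (x k) (Ht k)) (\<lambda>y. y \<in> Omega) xh \<and>
                v k = xh - x k) \<and>
          is_arg_min (\<lambda>a. penalty_barrier \<rho> \<omega> \<tau> S f c (x k + a *\<^sub>R v k))
            (\<lambda>a. 0 \<le> a \<and> x k + a *\<^sub>R v k \<in> Omega) (\<alpha> k) \<and>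
          x (Suc k) = x k + \<alpha> k *\<^sub>R v k)"

end

theory Submission
  imports Defs
begin

text \<open>
  Split \<open>\<phi> = F + R\<close> into the smooth penalty part \<open>F = f + norm c\<^sup>2 / (2 \<omega>)\<close> and the regularizer \<open>R\<close> made of
  the quadratic form of \<open>S\<close> and the logarithmic barrier. With the exact Hessian of the Lagrangian,
  \<open>q_k\<close> is the second order Taylor polynomial of \<open>F\<close> at \<open>x_k\<close> plus \<open>R\<close> itself, up to a constant
  (\<open>subproblem_eq_taylor\<close>). The step is thus a Newton step for \<open>grad F\<close> only, whereas \<open>grad R\<close> is
  treated without approximation. Since \<open>q_k\<close> is stationary at \<open>x_k + v_k\<close>, the value of
  \<open>grad \<phi>\<close> there is the remainder of the linearization of \<open>grad F\<close> at \<open>x_k\<close>. This remainder is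
  \<open>O(norm v_k\<^sup>2)\<close> uniformly on the bounded set \<open>Omega\<close>, because the blow-up of the barrier at the
  boundary has cancelled; this bounds the gradient after a full step.

  Suitability of the exact Hessian says that the Hessian of \<open>F\<close> is positive semi-definite at every
  iterate, and \<open>grad R\<close> is strongly monotone because of the barrier. Hence the step is a descent
  direction with \<open>norm v_k = O(norm (grad \<phi> x_k))\<close>, so that \<open>v_k\<close> tends to 0 along with the gradient.

  For the step size, compare \<open>grad \<phi>\<close> at \<open>x_k + v_k\<close>, where it is \<open>O(norm v_k\<^sup>2)\<close>, with \<open>grad \<phi>\<close> at
  \<open>x_(k+1)\<close>, where the exact line-search makes it orthogonal to \<open>v_k\<close>. Both points lie on one ray and
  differ by \<open>(1 - \<alpha>_k) v_k\<close>. Linearizing at \<open>x_(k+1)\<close>, which is an iterate and therefore again has a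
  positive semi-definite Hessian, strong monotonicity gives \<open>\<bar>1 - \<alpha>_k\<bar> norm v_k = O(norm v_k\<^sup>2)\<close>
  (\<open>line_search_defect\<close>), so that the step sizes tend to 1. Local Lipschitz continuity of \<open>grad \<phi>\<close> at the limit then
  bounds \<open>grad \<phi> x_(k+1)\<close> by \<open>O(norm v_k\<^sup>2) = O(norm (grad \<phi> x_k)\<^sup>2)\<close>, the second
  order convergence (\<open>quadratic_convergence\<close>).
\<close>

section \<open>Gradients, Hessians and Taylor remainders\<close>

lemma Omega_eq_box: "(Omega :: (real^'n) set) = box (-1) 1"
proof -
  have "infnorm x < 1 \<longleftrightarrow> (\<forall>i. \<bar>x $ i\<bar> < 1)" for x :: "real^'n"
  proof -
    have 1: "infnorm x = Max {\<bar>x $ i\<bar> | i. i \<in> UNIV}"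
      by (simp add: infnorm_cart cSup_eq_Max full_SetCompr_eq)
    show ?thesis
      unfolding 1 by (subst Max_less_iff) (auto simp: full_SetCompr_eq)
  qed
  then show ?thesis
    by (auto simp: Omega_def mem_box_cart abs_less_iff)
qed

lemma open_Omega: "open (Omega :: (real^'n) set)"
  and convex_Omega: "convex (Omega :: (real^'n) set)"
  and bounded_Omega: "bounded (Omega :: (real^'n) set)"
  by (simp_all add: Omega_eq_box open_box convex_box bounded_box)

lemma Omega_component: "x \<in> Omega \<Longrightarrow> \<bar>x $ i\<bar> < 1"
  by (auto simp: Omega_eq_box mem_box_cart abs_less_iff)

lemma vec_linear_functional:
  fixes g :: "real^'n \<Rightarrow> real"
  assumes "linear g"
  shows "g h = (\<chi> i. g (axis i 1)) \<bullet> h"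
proof -
  interpret linear g by fact
  have "g h = g (\<Sum>i\<in>UNIV. h $ i *\<^sub>R axis i 1)"
    by (simp add: basis_expansion flip: scalar_mult_eq_scaleR)
  also have "\<dots> = (\<Sum>i\<in>UNIV. h $ i * g (axis i 1))"
    by (simp add: sum scale)
  finally show ?thesis
    by (simp add: inner_vec_def mult.commute)
qed

lemma grad_inner:
  assumes "(g has_derivative g') (at x)"
  shows "grad g x \<bullet> h = g' h"
  using vec_linear_functional[OF has_derivative_linear[OF assms], of h]
  by (simp add: grad_def flip: frechet_derivative_at[OF assms])

lemma grad_eqI:
  assumes "(g has_derivative (\<lambda>h. w \<bullet> h)) (at x)"
  shows "grad g x = w"
  using grad_inner[OF assms] vector_eq_rdot by blast

lemma has_derivative_grad:
  "g differentiable at x \<Longrightarrow> (g has_derivative (\<lambda>h. grad g x \<bullet> h)) (at x)"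
  by (auto simp: differentiable_def grad_inner)

lemma jacobian_mult:
  fixes g :: "real^'n \<Rightarrow> real^'m"
  assumes "(g has_derivative g') (at x)"
  shows "jacobian g (at x) *v h = g' h"
  by (simp add: jacobian_def matrix_works has_derivative_linear[OF assms]
      flip: frechet_derivative_at[OF assms])

text \<open>
  The entries of a Hessian are awkward to compute with. As it depends only on the directional
  derivatives of \<open>g\<close>, it suffices to differentiate \<open>g' x h\<close> in \<open>x\<close> for each fixed \<open>h\<close>.
\<close>
lemma hessian_inner:
  assumes g: "\<And>x. (g has_derivative g' x) (at x)"
    and g': "\<And>h. ((\<lambda>x. g' x h) has_derivative (\<lambda>d. g'' d h)) (at y)"
    and lin: "\<And>d. linear (g'' d)"
  shows "h \<bullet> (hessian g y *v d) = g'' d h"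
proof -
  have "grad g = (\<lambda>x. \<chi> i. g' x (axis i 1))"
    by (simp add: fun_eq_iff grad_def flip: frechet_derivative_at[OF g])
  then have "(grad g has_derivative (\<lambda>d. \<chi> i. g'' d (axis i 1))) (at y)"
    by (subst has_derivative_componentwise_within) (auto simp: Basis_vec_def inner_axis intro: g')
  then have "hessian g y *v d = (\<chi> i. g'' d (axis i 1))"
    unfolding hessian_def by (rule jacobian_mult)
  then show ?thesis
    using vec_linear_functional[OF lin, of d h] by (simp add: inner_commute)
qed

lemma linearization_error:
  fixes g :: "'a::real_normed_vector \<Rightarrow> 'b::real_normed_vector" and g' :: "'a \<Rightarrow> 'a \<Rightarrow>\<^sub>L 'b"
  assumes "convex X" and g: "\<And>x. x \<in> X \<Longrightarrow> (g has_derivative blinfun_apply (g' x)) (at x)"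
    and L: "L-lipschitz_on X g'" and xy: "x \<in> X" "y \<in> X"
  shows "norm (g x - g y - g' y (x - y)) \<le> L * (norm (x - y))\<^sup>2"
proof -
  define T where "T = closed_segment y x"
  have sub: "T \<subseteq> X"
    using \<open>convex X\<close> xy by (simp add: T_def closed_segment_subset)
  have "norm (g x - g y - g' y (x - y)) \<le> norm (x - y) * (L * norm (x - y))"
  proof (rule differentiable_bound_linearization[of y x T g "\<lambda>x. blinfun_apply (g' x)" y])
    show "y + t *\<^sub>R (x - y) \<in> T" if "t \<in> {0..1}" for t :: real
      using that by (auto simp: T_def in_segment algebra_simps intro!: exI[of _ t])
    show "(g has_derivative blinfun_apply (g' z)) (at z within T)" if "z \<in> T" for z
      using g sub that by (blast intro: has_derivative_at_withinI)
    show "onorm (blinfun_apply (g' z) - blinfun_apply (g' y)) \<le> L * norm (x - y)" if "z \<in> T" for z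
    proof -
      have "onorm (blinfun_apply (g' z) - blinfun_apply (g' y)) = norm (g' z - g' y)"
        by (simp add: norm_blinfun.rep_eq fun_diff_def flip: blinfun.diff_left)
      also have "\<dots> \<le> L * norm (z - y)"
        using lipschitz_onD[OF L, of z y] sub that xy by (auto simp: dist_norm)
      also have "\<dots> \<le> L * norm (x - y)"
        using that segment_bound(1)[of z y x] lipschitz_on_nonneg[OF L]
        by (intro mult_left_mono) (auto simp: T_def norm_minus_commute)
      finally show ?thesis .
    qed
    show "y \<in> T" by (simp add: T_def)
  qed
  then show ?thesis by (simp add: power2_eq_square algebra_simps)
qed

text \<open>
  The second derivative is continuous, hence bounded on bounded sets, and on convex ones the mean
  value inequality passes the bounds down to the lower orders. A single constant serves for all of them.
\<close>
lemma twice_lipschitz_bounds: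
  fixes g :: "'a::euclidean_space \<Rightarrow> 'b::euclidean_space"
  assumes "twice_lipschitz_differentiable g" "bounded X" "convex X"
  obtains g' g'' K where
    "\<And>x. (g has_derivative blinfun_apply (g' x)) (at x)"
    "\<And>x. (g' has_derivative blinfun_apply (g'' x)) (at x)"
    "0 \<le> K"
    "\<And>x. x \<in> X \<Longrightarrow> norm (g x) \<le> K" "\<And>x. x \<in> X \<Longrightarrow> norm (g' x) \<le> K" "\<And>x. x \<in> X \<Longrightarrow> norm (g'' x) \<le> K"
    "\<And>x y. x \<in> X \<Longrightarrow> y \<in> X \<Longrightarrow> norm (g x - g y) \<le> K * norm (x - y)"
    "\<And>x y. x \<in> X \<Longrightarrow> y \<in> X \<Longrightarrow> norm (g x - g y - g' y (x - y)) \<le> K * (norm (x - y))\<^sup>2"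
    "\<And>x y. x \<in> X \<Longrightarrow> y \<in> X \<Longrightarrow> norm (g' x - g' y - g'' y (x - y)) \<le> K * (norm (x - y))\<^sup>2"
proof -
  obtain g' g'' L where
    g': "\<And>x. (g has_derivative blinfun_apply (g' x)) (at x)" and
    g'': "\<And>x. (g' has_derivative blinfun_apply (g'' x)) (at x)" and
    L: "L-lipschitz_on UNIV g''"
    using assms(1) unfolding twice_lipschitz_differentiable_def by blast
  have cont: "continuous_on UNIV g" "continuous_on UNIV g'" "continuous_on UNIV g''"
    using g' g'' L
    by (auto intro: has_derivative_continuous continuous_at_imp_continuous_on
        lipschitz_on_continuous_on)
  have bdd: "\<exists>B. \<forall>x\<in>X. norm (h x) \<le> B" if "continuous_on UNIV h"
    for h :: "'a \<Rightarrow> 'c::real_normed_vector"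
  proof -
    have "compact (h ` closure X)"
      using assms(2) that
      by (intro compact_continuous_image continuous_on_subset[OF that]) (auto simp: compact_closure)
    then have "bounded (h ` X)"
      using bounded_subset[OF compact_imp_bounded] closure_subset by (metis image_mono)
    then show ?thesis by (auto simp: bounded_iff)
  qed
  obtain B0 B1 B2 where B: "\<And>x. x \<in> X \<Longrightarrow> norm (g x) \<le> B0"
    "\<And>x. x \<in> X \<Longrightarrow> norm (g' x) \<le> B1" "\<And>x. x \<in> X \<Longrightarrow> norm (g'' x) \<le> B2"
    using bdd[OF cont(1)] bdd[OF cont(2)] bdd[OF cont(3)] by metis
  define K where "K = Max {B0, B1, B2, L, 0}"
  have K: "B0 \<le> K" "B1 \<le> K" "B2 \<le> K" "L \<le> K" "0 \<le> K"
    by (auto simp: K_def)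
  have le: "\<And>x. x \<in> X \<Longrightarrow> norm (g x) \<le> K" "\<And>x. x \<in> X \<Longrightarrow> norm (g' x) \<le> K" "\<And>x. x \<in> X \<Longrightarrow> norm (g'' x) \<le> K"
    using B K by (meson order_trans)+
  have lip: "K-lipschitz_on X g"
    using g' le(2) K \<open>convex X\<close>
    by (intro bounded_derivative_imp_lipschitz[where f' = "\<lambda>x. blinfun_apply (g' x)"])
       (auto simp: norm_blinfun.rep_eq[symmetric] intro: has_derivative_at_withinI)
  have lip': "K-lipschitz_on X g'"
    using g'' le(3) K \<open>convex X\<close>
    by (intro bounded_derivative_imp_lipschitz[where f' = "\<lambda>x. blinfun_apply (g'' x)"])
       (auto simp: norm_blinfun.rep_eq[symmetric] intro: has_derivative_at_withinI)
  have lip'': "K-lipschitz_on X g''"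
    using L K(4) by (meson lipschitz_on_mono subset_UNIV)
  show thesis
  proof (rule that[OF g' g'' K(5) le])
    show "norm (g x - g y) \<le> K * norm (x - y)" if "x \<in> X" "y \<in> X" for x y
      using lipschitz_onD[OF lip that] by (simp add: dist_norm)
  qed (use linearization_error[OF \<open>convex X\<close> g' lip'] linearization_error[OF \<open>convex X\<close> g'' lip''] in auto)
qed

section \<open>The smooth penalty part\<close>

definition penalty :: "real \<Rightarrow> (real^'n \<Rightarrow> real) \<Rightarrow> (real^'n \<Rightarrow> real^'m) \<Rightarrow> real^'n \<Rightarrow> real" where
  "penalty \<omega> f c x = f x + 1 / (2 * \<omega>) * (norm (c x))\<^sup>2"

definition penalty_hessian ::
    "real \<Rightarrow> (real^'n \<Rightarrow> real) \<Rightarrow> (real^'n \<Rightarrow> real^'m) \<Rightarrow> real^'n \<Rightarrow> real^'n^'n" where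
  "penalty_hessian \<omega> f c y = lagrangian_hessian \<omega> f c y
     + (1 / \<omega>) *\<^sub>R (trans_jacobian c y ** transpose (trans_jacobian c y))"

lemma gram_inner:
  fixes T :: "real^'m^'n"
  shows "h \<bullet> ((T ** transpose T) *v d) = (transpose T *v h) \<bullet> (transpose T *v d)"
  by (simp flip: matrix_vector_mul_assoc dot_lmul_matrix)

lemma trans_jacobian_mult:
  assumes "(c has_derivative c') (at x)"
  shows "transpose (trans_jacobian c x) *v h = c' h"
  unfolding trans_jacobian_def transpose_transpose by (rule jacobian_mult[OF assms])

lemma penalty_has_derivative:
  assumes f: "(f has_derivative f') (at x)" and c: "(c has_derivative c') (at x)"
  shows "(penalty \<omega> f c has_derivative (\<lambda>h. f' h + 1 / \<omega> * (c x \<bullet> c' h))) (at x)"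
proof -
  have "((\<lambda>x. f x + 1 / (2 * \<omega>) * (c x \<bullet> c x)) has_derivative
      (\<lambda>h. f' h + 1 / (2 * \<omega>) * (c x \<bullet> c' h + c' h \<bullet> c x))) (at x)"
    by (intro derivative_intros assms)
  then show ?thesis
    by (simp add: penalty_def[abs_def] power2_norm_eq_inner inner_commute add_divide_distrib)
qed

text \<open>
  The multiplier is frozen at \<open>- c y / \<omega>\<close>, which turns the constraint part of the Hessian of the
  Lagrangian into the curvature term \<open>c y \<bullet> c''\<close> of the squared penalty; the added Gram matrix is its
  Gauss-Newton term. So \<open>penalty_hessian\<close> is indeed the second derivative of \<open>penalty\<close>.
\<close>
lemma penalty_hessian_inner:
  assumes f: "\<And>x. (f has_derivative blinfun_apply (f' x)) (at x)"
    and f': "\<And>x. (f' has_derivative blinfun_apply (f'' x)) (at x)"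
    and c: "\<And>x. (c has_derivative blinfun_apply (c' x)) (at x)"
    and c': "\<And>x. (c' has_derivative blinfun_apply (c'' x)) (at x)"
  shows "h \<bullet> (penalty_hessian \<omega> f c y *v d)
    = f'' y d h + 1 / \<omega> * (c' y d \<bullet> c' y h + c y \<bullet> c'' y d h)"
proof -
  define l where "l = multiplier \<omega> c y"
  have "h \<bullet> (lagrangian_hessian \<omega> f c y *v d) = f'' y d h - l \<bullet> c'' y d h"
    unfolding lagrangian_hessian_def l_def[symmetric] lagrangian_def
  proof (rule hessian_inner)
    show "((\<lambda>x. f x - l \<bullet> c x) has_derivative (\<lambda>h. f' x h - l \<bullet> c' x h)) (at x)" for x
      by (intro derivative_intros f c)
    show "((\<lambda>x. f' x h - l \<bullet> c' x h) has_derivative (\<lambda>d. f'' y d h - l \<bullet> c'' y d h)) (at y)" for h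
      by (intro derivative_intros bounded_linear.has_derivative[OF blinfun.bounded_linear_left] f' c')
    show "linear (\<lambda>h. f'' y d h - l \<bullet> c'' y d h)" for d
      by (intro linearI) (simp_all add: blinfun.add_right blinfun.scaleR_right algebra_simps)
  qed
  then show ?thesis
    by (simp add: penalty_hessian_def matrix_vector_mult_add_rdistrib inner_add_right
        scaleR_matrix_vector_assoc[symmetric] gram_inner trans_jacobian_mult[OF c] l_def
        multiplier_def algebra_simps inner_commute del: transpose_matrix_vector)
qed

lemma norm_le_of_inner:
  fixes u :: "'a::real_inner"
  assumes "0 \<le> K" "\<And>h. h \<bullet> u \<le> K * norm h"
  shows "norm u \<le> K"
proof (cases "u = 0")
  case False
  have "norm u * norm u \<le> K * norm u"
    using assms(2)[of u] by (simp add: power2_norm_eq_inner flip: power2_eq_square)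
  then show ?thesis using False by simp
qed (use assms(1) in simp)

text \<open>
  Tested against \<open>h\<close>, the linearization error of the gradient of the squared penalty splits by the
  product rule into \<open>c x \<bullet> rc' h + rc \<bullet> c' y h + (c x - c y) \<bullet> c'' y d h\<close>, where \<open>d = x - y\<close> and \<open>rc\<close>,
  \<open>rc'\<close> are the linearization errors of \<open>c\<close> and \<open>c'\<close>. Each summand is quadratic in \<open>d\<close>.
\<close>
lemma penalty_estimates:
  fixes f :: "real^'n \<Rightarrow> real" and c :: "real^'n \<Rightarrow> real^'m"
  assumes "\<omega> > 0" "twice_lipschitz_differentiable f" "twice_lipschitz_differentiable c"
    and X: "bounded X" "convex X"
  obtains K where "0 \<le> K"
    "\<And>x y. x \<in> X \<Longrightarrow> y \<in> X \<Longrightarrow> norm (grad (penalty \<omega> f c) x - grad (penalty \<omega> f c) y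
        - penalty_hessian \<omega> f c y *v (x - y)) \<le> K * (norm (x - y))\<^sup>2"
    "\<And>y d. y \<in> X \<Longrightarrow> norm (penalty_hessian \<omega> f c y *v d) \<le> K * norm d"
proof -
  obtain f' f'' A where f: "\<And>x. (f has_derivative blinfun_apply (f' x)) (at x)"
    "\<And>x. (f' has_derivative blinfun_apply (f'' x)) (at x)"
    and A: "0 \<le> A" "\<And>x. x \<in> X \<Longrightarrow> norm (f'' x) \<le> A"
    "\<And>x y. x \<in> X \<Longrightarrow> y \<in> X \<Longrightarrow> norm (f' x - f' y - f'' y (x - y)) \<le> A * (norm (x - y))\<^sup>2"
    by (rule twice_lipschitz_bounds[OF assms(2) X]) (rule that)
  obtain c' c'' B where c: "\<And>x. (c has_derivative blinfun_apply (c' x)) (at x)"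
    "\<And>x. (c' has_derivative blinfun_apply (c'' x)) (at x)"
    and B: "0 \<le> B" "\<And>x. x \<in> X \<Longrightarrow> norm (c x) \<le> B" "\<And>x. x \<in> X \<Longrightarrow> norm (c' x) \<le> B"
    "\<And>x. x \<in> X \<Longrightarrow> norm (c'' x) \<le> B"
    "\<And>x y. x \<in> X \<Longrightarrow> y \<in> X \<Longrightarrow> norm (c x - c y) \<le> B * norm (x - y)"
    "\<And>x y. x \<in> X \<Longrightarrow> y \<in> X \<Longrightarrow> norm (c x - c y - c' y (x - y)) \<le> B * (norm (x - y))\<^sup>2"
    "\<And>x y. x \<in> X \<Longrightarrow> y \<in> X \<Longrightarrow> norm (c' x - c' y - c'' y (x - y)) \<le> B * (norm (x - y))\<^sup>2"
    by (rule twice_lipschitz_bounds[OF assms(3) X]) (rule that)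
  note hess = penalty_hessian_inner[OF f c, of _ \<omega>]
  define K where "K = A + 1 / \<omega> * (3 * B\<^sup>2)"
  have K0: "0 \<le> K" using A B \<open>\<omega> > 0\<close> by (simp add: K_def)
  have inner_le: "a \<bullet> b \<le> p * q" if "norm a \<le> p" "norm b \<le> q" for a b :: "'b::real_inner" and p q
    using that norm_cauchy_schwarz[of a b] norm_ge_zero
    by (meson mult_mono order_trans)
  have app: "norm (u h) \<le> p * norm h" if "norm u \<le> p" for u :: "'b::real_normed_vector \<Rightarrow>\<^sub>L 'c::real_normed_vector" and h p
    using that norm_blinfun[of u h] by (meson mult_right_mono norm_ge_zero order_trans)
  have app_real: "u h \<le> p * norm h" if "norm u \<le> p" for u :: "'b::real_normed_vector \<Rightarrow>\<^sub>L real" and h p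
    using app[OF that, of h] by simp
  show thesis
  proof (rule that[OF K0])
    fix y d assume y: "y \<in> X"
    show "norm (penalty_hessian \<omega> f c y *v d) \<le> K * norm d"
    proof (rule norm_le_of_inner, goal_cases)
      case 1 show ?case using K0 by simp
    next
      case (2 h)
      have 1: "f'' y d h \<le> A * norm d * norm h"
        by (intro app_real app A y)
      have 2: "c' y d \<bullet> c' y h \<le> (B * norm d) * (B * norm h)"
        by (intro inner_le app B y)
      have 3: "c y \<bullet> c'' y d h \<le> B * (B * norm d * norm h)"
        by (intro inner_le app B y)
      have "c' y d \<bullet> c' y h + c y \<bullet> c'' y d h \<le> 3 * B\<^sup>2 * (norm d * norm h)"
        using 2 3 mult_nonneg_nonneg[of "B\<^sup>2" "norm d * norm h"] by (simp add: power2_eq_square algebra_simps)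
      then have "1 / \<omega> * (c' y d \<bullet> c' y h + c y \<bullet> c'' y d h) \<le> 1 / \<omega> * (3 * B\<^sup>2 * (norm d * norm h))"
        using \<open>\<omega> > 0\<close> by (intro mult_left_mono) auto
      with 1 show ?case
        unfolding hess K_def by (simp add: algebra_simps)
    qed
  next
    fix x y assume xy: "x \<in> X" "y \<in> X"
    define d where "d = x - y"
    define rf where "rf = f' x - f' y - f'' y d"
    define rc where "rc = c x - c y - c' y d"
    define rc' where "rc' = c' x - c' y - c'' y d"
    have P: "h \<bullet> grad (penalty \<omega> f c) z = f' z h + 1 / \<omega> * (c z \<bullet> c' z h)" for z h
      using grad_inner[OF penalty_has_derivative[OF f(1) c(1), of \<omega> z], of h]
      by (simp add: inner_commute)
    show "norm (grad (penalty \<omega> f c) x - grad (penalty \<omega> f c) y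
        - penalty_hessian \<omega> f c y *v (x - y)) \<le> K * (norm (x - y))\<^sup>2"
      unfolding d_def[symmetric]
    proof (rule norm_le_of_inner, goal_cases)
      case 1 show ?case using K0 by simp
    next
      case (2 h)
      have 1: "rf h \<le> A * (norm d)\<^sup>2 * norm h"
        unfolding rf_def d_def by (intro app_real A xy)
      have 2: "c x \<bullet> rc' h \<le> B * (B * (norm d)\<^sup>2 * norm h)"
        unfolding rc'_def d_def by (intro inner_le app B xy)
      have 3: "rc \<bullet> c' y h \<le> (B * (norm d)\<^sup>2) * (B * norm h)"
        unfolding rc_def d_def by (intro inner_le app B xy)
      have 4: "(c x - c y) \<bullet> c'' y d h \<le> (B * norm d) * (B * norm d * norm h)"
        unfolding d_def by (intro inner_le app B xy)
      have eq: "h \<bullet> (grad (penalty \<omega> f c) x - grad (penalty \<omega> f c) y - penalty_hessian \<omega> f c y *v d)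
        = rf h + 1 / \<omega> * (c x \<bullet> rc' h + rc \<bullet> c' y h + (c x - c y) \<bullet> c'' y d h)"
        unfolding inner_diff_right P hess rf_def rc_def rc'_def
        by (simp add: blinfun.diff_left blinfun.add_left algebra_simps diff_divide_distrib add_divide_distrib)
      have "c x \<bullet> rc' h + rc \<bullet> c' y h + (c x - c y) \<bullet> c'' y d h \<le> 3 * B\<^sup>2 * ((norm d)\<^sup>2 * norm h)"
        using 2 3 4 by (simp add: power2_eq_square algebra_simps)
      then have "1 / \<omega> * (c x \<bullet> rc' h + rc \<bullet> c' y h + (c x - c y) \<bullet> c'' y d h)
          \<le> 1 / \<omega> * (3 * B\<^sup>2 * ((norm d)\<^sup>2 * norm h))"
        using \<open>\<omega> > 0\<close> by (intro mult_left_mono) auto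
      with 1 show ?case
        unfolding eq K_def by (simp add: algebra_simps)
    qed
  qed
qed

section \<open>The regularizer\<close>

definition regularizer_grad :: "real \<Rightarrow> real \<Rightarrow> real^'n^'n \<Rightarrow> real^'n \<Rightarrow> real^'n" where
  "regularizer_grad \<rho> \<tau> S x =
     \<rho> *\<^sub>R (S *v x) + \<tau> *\<^sub>R (\<chi> i. 1 / (1 - x $ i) - 1 / (1 + x $ i))"

lemma symmetric_matrix_inner:
  fixes A :: "real^'n^'n"
  assumes "transpose A = A"
  shows "u \<bullet> (A *v w) = w \<bullet> (A *v u)"
  using assms transpose_matrix_vector[of A u] by (simp add: inner_commute flip: dot_lmul_matrix)

lemma quadratic_form_has_derivative:
  fixes A :: "real^'n^'n"
  assumes "transpose A = A"
  shows "((\<lambda>x. (x - y) \<bullet> (A *v (x - y))) has_derivative (\<lambda>h. 2 * ((A *v (x - y)) \<bullet> h))) (at x)"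
proof -
  have "((\<lambda>x. (x - y) \<bullet> (A *v (x - y))) has_derivative
      (\<lambda>h. (x - y) \<bullet> (A *v (h - 0)) + (h - 0) \<bullet> (A *v (x - y)))) (at x)"
    by (intro derivative_intros bounded_linear.has_derivative[OF matrix_vector_mul_bounded_linear])
  moreover have "(x - y) \<bullet> (A *v h) = (A *v (x - y)) \<bullet> h" for h
    using symmetric_matrix_inner[OF assms, of "x - y" h] by (simp add: inner_commute)
  ultimately show ?thesis
    by (simp add: inner_commute[of _ "A *v (x - y)"])
qed

lemma log_barrier_has_derivative:
  assumes "x \<in> Omega"
  shows "(log_barrier has_derivative
     (\<lambda>h. - (\<chi> i. 1 / (1 - x $ i) - 1 / (1 + x $ i)) \<bullet> h)) (at x)"
proof -
  have *: "1 + x $ i > 0" "1 - x $ i > 0" for i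
    using Omega_component[OF assms, of i] by (auto simp: abs_less_iff)
  have "((\<lambda>x. ln (1 + x $ i) + ln (1 - x $ i)) has_derivative
      (\<lambda>h. - (1 / (1 - x $ i) - 1 / (1 + x $ i)) * h $ i)) (at x)" for i
    using *[of i]
    by (auto intro!: derivative_eq_intros bounded_linear.has_derivative[OF bounded_linear_vec_nth]
        simp: divide_simps algebra_simps)
  then have "((\<lambda>x. \<Sum>i\<in>UNIV. ln (1 + x $ i) + ln (1 - x $ i)) has_derivative
      (\<lambda>h. \<Sum>i\<in>UNIV. - (1 / (1 - x $ i) - 1 / (1 + x $ i)) * h $ i)) (at x)"
    by (intro has_derivative_sum) auto
  then show ?thesis
    by (simp add: log_barrier_def[abs_def] inner_vec_def)
qed

lemma regularizer_has_derivative: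
  fixes S :: "real^'n^'n"
  assumes "transpose S = S" "x \<in> Omega"
  shows "((\<lambda>x. \<rho> / 2 * (x \<bullet> (S *v x)) - \<tau> * log_barrier x) has_derivative
     (\<lambda>h. regularizer_grad \<rho> \<tau> S x \<bullet> h)) (at x)"
  using has_derivative_diff[OF
      has_derivative_mult_right[OF quadratic_form_has_derivative[OF assms(1), of 0 x], of "\<rho> / 2"]
      has_derivative_mult_right[OF log_barrier_has_derivative[OF assms(2)], of \<tau>]]
  by (simp add: regularizer_grad_def inner_add_left)

text \<open>
  This factorization gives both properties of the barrier that matter: the first factor is at least
  \<open>1/2\<close> on all of \<open>(-1, 1)\<close>, and it is bounded away from the ends of the interval.
\<close>
lemma barrier_slope_diff:
  fixes s t :: real
  assumes "\<bar>s\<bar> < 1" "\<bar>t\<bar> < 1"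
  shows "(1 / (1 - s) - 1 / (1 + s)) - (1 / (1 - t) - 1 / (1 + t))
    = (1 / ((1 - s) * (1 - t)) + 1 / ((1 + s) * (1 + t))) * (s - t)"
  using assms by (simp add: abs_less_iff divide_simps) algebra

lemma barrier_slope_monotone:
  fixes s t :: real
  assumes "\<bar>s\<bar> < 1" "\<bar>t\<bar> < 1"
  shows "1 / 2 * (s - t)\<^sup>2 \<le>
    ((1 / (1 - s) - 1 / (1 + s)) - (1 / (1 - t) - 1 / (1 + t))) * (s - t)"
proof -
  have "1 / (2 * 2) \<le> 1 / ((1 - s) * (1 - t))" "1 / (2 * 2) \<le> 1 / ((1 + s) * (1 + t))"
    using assms by (intro divide_left_mono mult_mono mult_pos_pos; simp add: abs_less_iff)+
  then have "1 / 2 * (s - t)\<^sup>2 \<le> (1 / ((1 - s) * (1 - t)) + 1 / ((1 + s) * (1 + t))) * (s - t)\<^sup>2"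
    by (intro mult_right_mono) auto
  then show ?thesis
    unfolding barrier_slope_diff[OF assms] by (simp add: power2_eq_square)
qed

lemma barrier_slope_lipschitz:
  fixes s t :: real
  assumes "0 < e" "\<bar>s\<bar> \<le> 1 - e" "\<bar>t\<bar> \<le> 1 - e"
  shows "\<bar>(1 / (1 - s) - 1 / (1 + s)) - (1 / (1 - t) - 1 / (1 + t))\<bar> \<le> 2 / e\<^sup>2 * \<bar>s - t\<bar>"
proof -
  have lt: "\<bar>s\<bar> < 1" "\<bar>t\<bar> < 1" using assms by auto
  have "1 / ((1 - s) * (1 - t)) \<le> 1 / (e * e)" "1 / ((1 + s) * (1 + t)) \<le> 1 / (e * e)"
    using assms by (intro divide_left_mono mult_mono mult_pos_pos; simp add: abs_le_iff)+
  moreover have "0 \<le> 1 / ((1 - s) * (1 - t))" "0 \<le> 1 / ((1 + s) * (1 + t))"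
    using lt by (intro divide_nonneg_nonneg mult_nonneg_nonneg; simp add: abs_less_iff)+
  ultimately have "\<bar>1 / ((1 - s) * (1 - t)) + 1 / ((1 + s) * (1 + t))\<bar> \<le> 2 / e\<^sup>2"
    by (simp add: power2_eq_square)
  then show ?thesis
    unfolding barrier_slope_diff[OF lt] abs_mult by (rule mult_right_mono) simp
qed

lemma regularizer_grad_strongly_monotone:
  fixes S :: "real^'n^'n"
  assumes "\<rho> \<ge> 0" "\<tau> \<ge> 0" "\<And>u. 0 \<le> u \<bullet> (S *v u)" "x \<in> Omega" "y \<in> Omega"
  shows "\<tau> / 2 * (norm (x - y))\<^sup>2 \<le>
    (regularizer_grad \<rho> \<tau> S x - regularizer_grad \<rho> \<tau> S y) \<bullet> (x - y)"
proof -
  define b where "b z = (\<chi> i. 1 / (1 - z $ i) - 1 / (1 + z $ i))" for z :: "real^'n"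
  have "1 / 2 * (norm (x - y))\<^sup>2 = (\<Sum>i\<in>UNIV. 1 / 2 * (x $ i - y $ i)\<^sup>2)"
    by (simp add: norm_vec_def L2_set_def sum_nonneg sum_distrib_left)
  also have "\<dots> \<le> (b x - b y) \<bullet> (x - y)"
    unfolding inner_vec_def
    using barrier_slope_monotone[OF Omega_component[OF assms(4)] Omega_component[OF assms(5)]]
    by (intro sum_mono) (simp add: b_def)
  finally have "\<tau> * (1 / 2 * (norm (x - y))\<^sup>2) \<le> \<tau> * ((b x - b y) \<bullet> (x - y))"
    using assms(2) by (rule mult_left_mono)
  moreover have "0 \<le> \<rho> * ((x - y) \<bullet> (S *v (x - y)))"
    using assms(1,3) by simp
  ultimately show ?thesis
    unfolding regularizer_grad_def b_def[symmetric]
    by (simp add: inner_commute algebra_simps)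
qed

lemma regularizer_grad_locally_lipschitz:
  fixes S :: "real^'n^'n"
  assumes "xs \<in> Omega"
  obtains \<delta> K where "\<delta> > 0" "0 \<le> K"
    "\<And>x y. x \<in> ball xs \<delta> \<Longrightarrow> y \<in> ball xs \<delta> \<Longrightarrow>
       norm (regularizer_grad \<rho> \<tau> S x - regularizer_grad \<rho> \<tau> S y) \<le> K * norm (x - y)"
proof -
  define e where "e = (1 - infnorm xs) / 2"
  have e: "0 < e" "infnorm xs = 1 - 2 * e" using assms by (auto simp: e_def Omega_def field_simps)
  define b where "b z = (\<chi> i. 1 / (1 - z $ i) - 1 / (1 + z $ i))" for z :: "real^'n"
  define K where "K = \<bar>\<rho>\<bar> * onorm ((*v) S) + \<bar>\<tau>\<bar> * (2 / e\<^sup>2)"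
  have K: "0 \<le> K"
    by (auto simp: K_def intro!: add_nonneg_nonneg mult_nonneg_nonneg onorm_pos_le)
  have le: "\<bar>x $ i\<bar> \<le> 1 - e" if "x \<in> ball xs e" for x i
  proof -
    have "\<bar>x $ i\<bar> \<le> \<bar>xs $ i\<bar> + \<bar>(xs - x) $ i\<bar>" by simp
    also have "\<dots> \<le> infnorm xs + norm (xs - x)"
      by (intro add_mono component_le_infnorm_cart component_le_norm_cart)
    finally show ?thesis using that e by (simp add: dist_norm)
  qed
  show thesis
  proof (rule that[OF e(1) K])
    fix x y assume xy: "x \<in> ball xs e" "y \<in> ball xs e"
    have "norm (b x - b y) \<le> norm ((2 / e\<^sup>2) *\<^sub>R (x - y))"
      using barrier_slope_lipschitz[OF e(1) le[OF xy(1)] le[OF xy(2)]]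
      by (intro norm_le_componentwise_cart) (simp add: b_def abs_mult del: right_diff_distrib_numeral)
    then have 1: "norm (b x - b y) \<le> 2 / e\<^sup>2 * norm (x - y)" by simp
    have 2: "norm (S *v (x - y)) \<le> onorm ((*v) S) * norm (x - y)"
      by (intro onorm) simp
    have "regularizer_grad \<rho> \<tau> S x - regularizer_grad \<rho> \<tau> S y
      = \<rho> *\<^sub>R (S *v (x - y)) + \<tau> *\<^sub>R (b x - b y)"
      unfolding regularizer_grad_def b_def[symmetric] by (simp add: algebra_simps)
    also have "norm \<dots> \<le> \<bar>\<rho>\<bar> * norm (S *v (x - y)) + \<bar>\<tau>\<bar> * norm (b x - b y)"
      by (rule order_trans[OF norm_triangle_ineq]) simp
    also have "\<dots> \<le> \<bar>\<rho>\<bar> * (onorm ((*v) S) * norm (x - y)) + \<bar>\<tau>\<bar> * (2 / e\<^sup>2 * norm (x - y))"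
      using 1 2 by (intro add_mono mult_left_mono) auto
    finally show "norm (regularizer_grad \<rho> \<tau> S x - regularizer_grad \<rho> \<tau> S y) \<le> K * norm (x - y)"
      by (simp add: K_def algebra_simps)
  qed
qed

section \<open>The objective and its subproblems\<close>

lemma penalty_barrier_has_derivative:
  assumes "transpose S = S" "x \<in> Omega" "penalty \<omega> f c differentiable at x"
  shows "(penalty_barrier \<rho> \<omega> \<tau> S f c has_derivative
    (\<lambda>h. (grad (penalty \<omega> f c) x + regularizer_grad \<rho> \<tau> S x) \<bullet> h)) (at x)"
proof -
  have "penalty_barrier \<rho> \<omega> \<tau> S f c
    = (\<lambda>x. penalty \<omega> f c x + (\<rho> / 2 * (x \<bullet> (S *v x)) - \<tau> * log_barrier x))"
    by (auto simp: penalty_barrier_def penalty_def)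
  then show ?thesis
    using has_derivative_add[OF has_derivative_grad[OF assms(3)]
        regularizer_has_derivative[OF assms(1,2), of \<rho> \<tau>]]
    by (simp add: inner_add_left)
qed

text \<open>
  The term \<open>norm (A x - b)\<^sup>2 / (2 \<omega>)\<close> equals \<open>norm (A (x - y) + c y)\<^sup>2 / (2 \<omega>)\<close>; expanding it yields the
  Gauss-Newton part of the Hessian and the penalty part of the gradient. Recentring the remaining
  quadratic at \<open>y\<close> needs the symmetry of the Hessian of the Lagrangian.
\<close>
lemma subproblem_eq_taylor:
  fixes \<omega> :: real and f :: "real^'n \<Rightarrow> real" and c :: "real^'n \<Rightarrow> real^'m"
  defines "H \<equiv> \<lambda>y. lagrangian_hessian \<omega> f c y"
  assumes "transpose (penalty_hessian \<omega> f c y) = penalty_hessian \<omega> f c y"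
    and "f differentiable at y" "c differentiable at y"
  shows "subproblem \<rho> \<omega> \<tau> S f c y (H y) x =
    (grad f y \<bullet> y - 1 / 2 * (y \<bullet> (H y *v y)) + 1 / (2 * \<omega>) * (norm (c y))\<^sup>2)
    + grad (penalty \<omega> f c) y \<bullet> (x - y) + 1 / 2 * ((x - y) \<bullet> (penalty_hessian \<omega> f c y *v (x - y)))
    + (\<rho> / 2 * (x \<bullet> (S *v x)) - \<tau> * log_barrier x)"
proof -
  obtain f' c' where f: "(f has_derivative f') (at y)" and c: "(c has_derivative c') (at y)"
    using assms(3,4) by (auto simp: differentiable_def)
  define A where "A = transpose (trans_jacobian c y)"
  have hess: "u \<bullet> (penalty_hessian \<omega> f c y *v w) = u \<bullet> (H y *v w) + 1 / \<omega> * ((A *v u) \<bullet> (A *v w))" for u w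
    unfolding penalty_hessian_def H_def A_def
    by (simp add: matrix_vector_mult_add_rdistrib inner_add_right
        scaleR_matrix_vector_assoc[symmetric] gram_inner del: transpose_matrix_vector)
  have sym: "u \<bullet> (H y *v w) = w \<bullet> (H y *v u)" for u w
    using symmetric_matrix_inner[OF assms(2), of u w] unfolding hess by (simp add: inner_commute)
  have grad: "grad (penalty \<omega> f c) y \<bullet> h = grad f y \<bullet> h + 1 / \<omega> * (c y \<bullet> (A *v h))" for h
    using grad_inner[OF penalty_has_derivative[OF f c], of \<omega> h] grad_inner[OF f, of h]
      trans_jacobian_mult[OF c, of h]
    by (simp add: A_def del: transpose_matrix_vector)
  have "1 / (2 * \<omega>) * (norm (A *v x - (- c y + A *v y)))\<^sup>2 =
    1 / (2 * \<omega>) * ((A *v (x - y)) \<bullet> (A *v (x - y))) + 1 / \<omega> * (c y \<bullet> (A *v (x - y)))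
    + 1 / (2 * \<omega>) * (norm (c y))\<^sup>2"
    by (simp add: power2_norm_eq_inner algebra_simps inner_commute add_divide_distrib diff_divide_distrib)
  moreover have "1 / 2 * (x \<bullet> (H y *v x)) + (grad f y - H y *v y) \<bullet> x
    = grad f y \<bullet> y - 1 / 2 * (y \<bullet> (H y *v y)) + grad f y \<bullet> (x - y) + 1 / 2 * ((x - y) \<bullet> (H y *v (x - y)))"
    using sym[of x y] by (simp add: algebra_simps inner_commute)
  ultimately show ?thesis
    unfolding subproblem_def Let_def A_def[symmetric] hess grad
    by (simp add: matrix_vector_mult_add_rdistrib inner_add_right
        scaleR_matrix_vector_assoc[symmetric] distrib_left)
qed

lemma subproblem_has_derivative:
  fixes f :: "real^'n \<Rightarrow> real" and c :: "real^'n \<Rightarrow> real^'m"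
  assumes "transpose S = S" "x \<in> Omega"
    and "transpose (penalty_hessian \<omega> f c y) = penalty_hessian \<omega> f c y"
    and "f differentiable at y" "c differentiable at y"
  shows "(subproblem \<rho> \<omega> \<tau> S f c y (lagrangian_hessian \<omega> f c y) has_derivative
    (\<lambda>h. (grad (penalty \<omega> f c) y + penalty_hessian \<omega> f c y *v (x - y)
       + regularizer_grad \<rho> \<tau> S x) \<bullet> h)) (at x)"
proof -
  define M where "M = penalty_hessian \<omega> f c y"
  have lin: "((\<lambda>x. C + g \<bullet> (x - y)) has_derivative (\<lambda>h. g \<bullet> h)) (at x)" for C and g :: "real^'n"
    by (auto intro!: derivative_eq_intros)
  have quad: "((\<lambda>x. 1 / 2 * ((x - y) \<bullet> (M *v (x - y)))) has_derivative
      (\<lambda>h. 1 / 2 * (2 * ((M *v (x - y)) \<bullet> h)))) (at x)"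
    unfolding M_def by (intro has_derivative_mult_right quadratic_form_has_derivative assms)
  show ?thesis
    unfolding subproblem_eq_taylor[OF assms(3-5), abs_def] M_def[symmetric]
    by (rule has_derivative_eq_rhs[OF has_derivative_add[OF has_derivative_add[OF lin quad]
            regularizer_has_derivative[OF assms(1,2)]]])
       (simp add: fun_eq_iff inner_add_left)
qed

section \<open>Exact line-search\<close>

text \<open>
  The step size 0 lies on the boundary of the admissible range, so there the slope is only known to
  be nonnegative.
\<close>
lemma exact_line_search:
  fixes \<phi> :: "'a::real_inner \<Rightarrow> real"
  assumes "open U" and g: "(\<phi> has_derivative (\<lambda>h. g \<bullet> h)) (at (y + a *\<^sub>R v))"
    and min: "is_arg_min (\<lambda>a. \<phi> (y + a *\<^sub>R v)) (\<lambda>a. 0 \<le> a \<and> y + a *\<^sub>R v \<in> U) a"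
  shows "0 \<le> g \<bullet> v" and "0 < a \<Longrightarrow> g \<bullet> v = 0"
proof -
  have a: "0 \<le> a" "y + a *\<^sub>R v \<in> U"
    and le: "\<And>b. 0 \<le> b \<Longrightarrow> y + b *\<^sub>R v \<in> U \<Longrightarrow> \<phi> (y + a *\<^sub>R v) \<le> \<phi> (y + b *\<^sub>R v)"
    using min by (auto simp: is_arg_min_linorder)
  have "((\<lambda>b. \<phi> (y + b *\<^sub>R v)) has_derivative (\<lambda>t. g \<bullet> (t *\<^sub>R v))) (at a)"
    by (rule has_derivative_compose[where f = "\<lambda>b. y + b *\<^sub>R v" and g = \<phi>, OF _ g])
       (auto intro!: derivative_eq_intros)
  then have der: "DERIV (\<lambda>b. \<phi> (y + b *\<^sub>R v)) a :> g \<bullet> v"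
    by (simp add: has_field_derivative_def mult_commute_abs)
  have "open ((\<lambda>b. y + b *\<^sub>R v) -` U)"
    using \<open>open U\<close> by (intro open_vimage continuous_intros)
  then obtain e where e: "e > 0" "\<And>b. \<bar>b - a\<bar> < e \<Longrightarrow> y + b *\<^sub>R v \<in> U"
    using a(2) by (auto simp: open_dist dist_real_def)
  show nonneg: "0 \<le> g \<bullet> v"
  proof (rule ccontr)
    assume "\<not> 0 \<le> g \<bullet> v"
    then obtain d where d: "d > 0" "\<And>h. 0 < h \<Longrightarrow> h < d \<Longrightarrow> \<phi> (y + (a + h) *\<^sub>R v) < \<phi> (y + a *\<^sub>R v)"
      using DERIV_neg_dec_right[OF der] by auto
    define h where "h = min d e / 2"
    have "0 < h" "h < d" "h < e" using d(1) e(1) by (auto simp: h_def)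
    then show False
      using d(2)[of h] le[of "a + h"] e(2)[of "a + h"] a(1) by auto
  qed
  show "g \<bullet> v = 0" if "0 < a"
    by (rule DERIV_local_min[OF der, of "min a e"]) (use that e le in auto)
qed

section \<open>Newton steps for one of two summands with exact line-search\<close>

text \<open>
  To solve \<open>P + B = 0\<close>, only \<open>P\<close> is linearized, by \<open>D\<close>, and \<open>B\<close> is strongly monotone. The operators
  \<open>D y\<close> are required to be positive semi-definite at the iterates only, since this is all that
  suitability provides.
\<close>
locale split_newton =
  fixes P B :: "'a::real_inner \<Rightarrow> 'a" and D :: "'a \<Rightarrow> 'a \<Rightarrow> 'a" and X :: "'a set"
    and x v :: "nat \<Rightarrow> 'a" and \<alpha> :: "nat \<Rightarrow> real" and \<mu> K :: real
  assumes \<mu>_pos: "0 < \<mu>" and K_nonneg: "0 \<le> K"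
    and taylor: "\<And>y z. y \<in> X \<Longrightarrow> z \<in> X \<Longrightarrow> norm (P z - P y - D y (z - y)) \<le> K * (norm (z - y))\<^sup>2"
    and monotone: "\<And>y z. y \<in> X \<Longrightarrow> z \<in> X \<Longrightarrow> \<mu> * (norm (z - y))\<^sup>2 \<le> (B z - B y) \<bullet> (z - y)"
    and iterate: "\<And>k. x k \<in> X" "\<And>k. x k + v k \<in> X" "\<And>k. x (Suc k) = x k + \<alpha> k *\<^sub>R v k"
    and psd: "\<And>k u. 0 \<le> u \<bullet> D (x k) u"
    and model: "\<And>k. P (x k) + D (x k) (v k) + B (x k + v k) = 0"
begin

definition G :: "'a \<Rightarrow> 'a" where "G z = P z + B z"

text \<open>
  By the model equation the contribution of \<open>B\<close> at the new point cancels, and the residual is the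
  linearization error of \<open>P\<close> alone.
\<close>
lemma full_step_residual: "norm (G (x k + v k)) \<le> K * (norm (v k))\<^sup>2"
proof -
  have "G (x k + v k) = P (x k + v k) - P (x k) - D (x k) (v k)"
    using model[of k] by (simp add: G_def algebra_simps eq_neg_iff_add_eq_0)
  then show ?thesis
    using taylor[OF iterate(1,2), of k k] by simp
qed

lemma descent: "\<mu> * (norm (v k))\<^sup>2 \<le> - (G (x k) \<bullet> v k)"
proof -
  have "G (x k) = - (D (x k) (v k)) - (B (x k + v k) - B (x k))"
    using model[of k] by (simp add: G_def algebra_simps eq_neg_iff_add_eq_0)
  then show ?thesis
    using monotone[OF iterate(1,2), of k k] psd[of "v k" k]
    by (simp add: inner_diff_left inner_diff_right inner_commute)
qed

lemma step_le_residual: "\<mu> * norm (v k) \<le> norm (G (x k))"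
proof (cases "v k = 0")
  case False
  have "(\<mu> * norm (v k)) * norm (v k) \<le> norm (G (x k)) * norm (v k)"
    using descent[of k] norm_cauchy_schwarz[of "- G (x k)" "v k"]
    by (simp add: power2_eq_square algebra_simps)
  then show ?thesis using False by simp
qed simp

text \<open>
  The point reached by the full step and the one chosen by the line-search are compared by
  linearizing \<open>P\<close> at \<open>x (Suc k)\<close>, where \<open>D\<close> is positive semi-definite, whereas nothing is
  known about the sign of \<open>D\<close> at the end of the full step. Testing with \<open>d\<close>, a multiple of \<open>v k\<close>, removes \<open>G (x (Suc k))\<close>.
\<close>
lemma line_search_defect:
  assumes "G (x (Suc k)) \<bullet> v k = 0"
  defines "d \<equiv> x k + v k - x (Suc k)"
  shows "(\<mu> - K * norm d) * norm d \<le> K * (norm (v k))\<^sup>2"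
proof (cases "d = 0")
  case False
  define z where "z = x k + v k"
  have d: "d = (1 - \<alpha> k) *\<^sub>R v k"
    unfolding d_def iterate(3) by (simp add: algebra_simps)
  have zd: "z - x (Suc k) = d" by (simp add: z_def d_def)
  have z: "z \<in> X" by (simp add: z_def iterate)
  have "- (K * (norm d)\<^sup>2 * norm d) \<le> - (norm (P z - P (x (Suc k)) - D (x (Suc k)) d) * norm d)"
    using taylor[OF iterate(1) z, of "Suc k"] by (simp add: zd mult_right_mono)
  also have "\<dots> \<le> (P z - P (x (Suc k)) - D (x (Suc k)) d) \<bullet> d"
    using norm_cauchy_schwarz[of "- (P z - P (x (Suc k)) - D (x (Suc k)) d)" d]
    by (metis inner_minus_left minus_le_iff norm_minus_cancel)
  also have "\<dots> \<le> (P z - P (x (Suc k))) \<bullet> d"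
    using psd[of d "Suc k"] by (simp add: inner_diff_left inner_diff_right inner_commute)
  finally have "\<mu> * (norm d)\<^sup>2 - K * (norm d)\<^sup>2 * norm d \<le> (G z - G (x (Suc k))) \<bullet> d"
    using monotone[OF iterate(1) z, of "Suc k"] by (simp add: zd G_def inner_add_left inner_diff_left)
  also have "\<dots> = G z \<bullet> d"
    using assms(1) by (simp add: d inner_diff_left)
  also have "\<dots> \<le> K * (norm (v k))\<^sup>2 * norm d"
    using norm_cauchy_schwarz mult_right_mono[OF full_step_residual[of k, folded z_def] norm_ge_zero]
    by (rule order_trans)
  finally have "((\<mu> - K * norm d) * norm d) * norm d \<le> K * (norm (v k))\<^sup>2 * norm d"
    by (simp add: power2_eq_square algebra_simps)
  then show ?thesis using False by simp
qed (simp add: K_nonneg)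

text \<open>
  Once \<open>K * norm d < \<mu> / 2\<close>, the previous lemma bounds the defect \<open>d = (1 - \<alpha> k) *\<^sub>R v k\<close> by a multiple
  of \<open>norm (v k)\<^sup>2\<close>. Dividing by \<open>norm (v k)\<close> controls the step size, and the Lipschitz
  condition carries the estimate of the full step over to the step taken.
\<close>
lemma quadratic_convergence:
  assumes lim: "x \<longlonglongrightarrow> xs" and "G xs = 0"
    and lip: "0 < \<delta>" "0 \<le> L"
      "\<And>y z. y \<in> ball xs \<delta> \<Longrightarrow> z \<in> ball xs \<delta> \<Longrightarrow> norm (G y - G z) \<le> L * norm (y - z)"
    and line: "\<And>k. G (x (Suc k)) \<bullet> v k = 0"
  shows "(\<lambda>k. norm (G (x k))) \<longlonglongrightarrow> 0"
    and "\<epsilon> > 0 \<Longrightarrow> \<forall>\<^sub>F k in sequentially. v k \<noteq> 0 \<longrightarrow> \<bar>\<alpha> k - 1\<bar> < \<epsilon>"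
    and "\<exists>C. \<forall>\<^sub>F k in sequentially. norm (G (x (Suc k))) \<le> C * (norm (G (x k)))\<^sup>2"
proof -
  define z where "z k = x k + v k" for k
  define d where "d k = z k - x (Suc k)" for k
  have near: "\<forall>\<^sub>F k in sequentially. y k \<in> ball xs \<delta>" if "y \<longlonglongrightarrow> xs" for y :: "nat \<Rightarrow> 'a"
    using tendstoD[OF that \<open>0 < \<delta>\<close>] by (simp add: dist_commute)
  have bound: "\<forall>\<^sub>F k in sequentially. norm (G (x k)) \<le> L * norm (x k - xs)"
    using near[OF lim] by eventually_elim (use lip(1) lip(3)[of _ xs] \<open>G xs = 0\<close> in auto)
  have "(\<lambda>k. L * norm (x k - xs)) \<longlonglongrightarrow> L * norm (xs - xs)"
    by (intro tendsto_intros lim)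
  then show G0: "(\<lambda>k. norm (G (x k))) \<longlonglongrightarrow> 0"
    by (intro tendsto_sandwich[OF always_eventually bound tendsto_const]) auto
  have vG: "norm (v k) \<le> norm (G (x k)) / \<mu>" for k
    using step_le_residual[of k] \<mu>_pos by (simp add: field_simps)
  have "(\<lambda>k. norm (G (x k)) / \<mu>) \<longlonglongrightarrow> 0"
    using tendsto_divide[OF G0 tendsto_const[of \<mu>]] \<mu>_pos by simp
  then have v0: "v \<longlonglongrightarrow> 0"
    by (rule Lim_null_comparison[rotated]) (simp add: vG)
  have zlim: "z \<longlonglongrightarrow> xs"
    using tendsto_add[OF lim v0] by (simp add: z_def[abs_def])
  have xlim: "(\<lambda>k. x (Suc k)) \<longlonglongrightarrow> xs"
    by (rule LIMSEQ_Suc[OF lim])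
  have "(\<lambda>k. K * norm (d k)) \<longlonglongrightarrow> K * norm (xs - xs)"
    unfolding d_def by (intro tendsto_intros zlim xlim)
  then have small: "\<forall>\<^sub>F k in sequentially. K * norm (d k) < \<mu> / 2"
    by (rule order_tendstoD(2)) (simp add: \<mu>_pos)
  define C where "C = 2 * K / \<mu>"
  have C: "0 \<le> C" using \<mu>_pos K_nonneg by (simp add: C_def)
  have defect: "\<forall>\<^sub>F k in sequentially. norm (d k) \<le> C * (norm (v k))\<^sup>2"
    using small
  proof eventually_elim
    case (elim k)
    have "\<mu> / 2 * norm (d k) \<le> (\<mu> - K * norm (d k)) * norm (d k)"
      using elim by (intro mult_right_mono) auto
    also have "\<dots> \<le> K * (norm (v k))\<^sup>2"
      using line_search_defect[OF line, of k] by (simp add: d_def z_def)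
    finally show ?case using \<mu>_pos by (simp add: C_def field_simps)
  qed
  show "\<forall>\<^sub>F k in sequentially. v k \<noteq> 0 \<longrightarrow> \<bar>\<alpha> k - 1\<bar> < \<epsilon>" if "\<epsilon> > 0"
  proof -
    have "(\<lambda>k. C * norm (v k)) \<longlonglongrightarrow> C * norm (0::'a)"
      by (intro tendsto_intros v0)
    then have "\<forall>\<^sub>F k in sequentially. C * norm (v k) < \<epsilon>"
      by (rule order_tendstoD(2)) (simp add: that)
    with defect show ?thesis
    proof eventually_elim
      case (elim k)
      have "d k = (1 - \<alpha> k) *\<^sub>R v k"
        unfolding d_def z_def iterate(3) by (simp add: algebra_simps)
      then have "\<bar>\<alpha> k - 1\<bar> * norm (v k) \<le> (C * norm (v k)) * norm (v k)"
        using elim(1) by (simp add: power2_eq_square abs_minus_commute)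
      then show ?case using elim(2) by auto
    qed
  qed
  have "\<forall>\<^sub>F k in sequentially. norm (G (x (Suc k))) \<le> (K + L * C) / \<mu>\<^sup>2 * (norm (G (x k)))\<^sup>2"
    using defect near[OF zlim] near[OF xlim]
  proof eventually_elim
    case (elim k)
    have "norm (G (x (Suc k))) \<le> norm (G (z k)) + norm (G (z k) - G (x (Suc k)))"
      by (metis add.commute norm_minus_commute norm_triangle_sub)
    also have "\<dots> \<le> K * (norm (v k))\<^sup>2 + L * (C * (norm (v k))\<^sup>2)"
      using lip(3)[OF elim(2,3)] elim(1) full_step_residual[of k] lip(2)
      by (intro add_mono order_trans[OF lip(3)[OF elim(2,3)]] mult_left_mono) (auto simp: z_def d_def)
    also have "\<dots> = (K + L * C) * (norm (v k))\<^sup>2" by (simp add: algebra_simps)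
    also have "\<dots> \<le> (K + L * C) * (norm (G (x k)) / \<mu>)\<^sup>2"
      using vG[of k] K_nonneg lip(2) C by (intro mult_left_mono power_mono) auto
    finally show ?case by (simp add: power_divide)
  qed
  then show "\<exists>C. \<forall>\<^sub>F k in sequentially. norm (G (x (Suc k))) \<le> C * (norm (G (x k)))\<^sup>2" ..
qed

end

section \<open>Local convergence of the interior point method\<close>

theorem mainTheorem2:
  fixes \<rho> \<omega> \<tau> :: real
    and S :: "real^'n^'n"
    and f :: "real^'n \<Rightarrow> real"
    and c :: "real^'n \<Rightarrow> real^'m"
    and Ht :: "nat \<Rightarrow> real^'n^'n"
    and x v :: "nat \<Rightarrow> real^'n"
    and \<alpha> :: "nat \<Rightarrow> real"
    and xstar :: "real^'n"
  defines "\<phi> \<equiv> penalty_barrier \<rho> \<omega> \<tau> S f c"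
  assumes pos: "\<rho> > 0" "\<omega> > 0" "\<tau> > 0"
    and S: "sym_pos_def S"
    and f: "bounded (range f)" "twice_lipschitz_differentiable f"
    and c: "bounded (range c)" "twice_lipschitz_differentiable c"
    and run: "ppd_ipm \<rho> \<omega> \<tau> S f c Ht x v \<alpha>"
    and exact_suitable: "\<And>k. suitable \<omega> c (x k) (lagrangian_hessian \<omega> f c (x k))"
    and exact_chosen: "\<And>k. Ht k = lagrangian_hessian \<omega> f c (x k)"
    and global_convergence: "xstar \<in> Omega" "grad \<phi> xstar = 0" "x \<longlonglongrightarrow> xstar"
  shows "(\<exists>C. \<forall>k. \<alpha> k = 1 \<longrightarrow> norm (grad \<phi> (x k + \<alpha> k *\<^sub>R v k)) \<le> C * (norm (v k))\<^sup>2) \<and>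
         (\<forall>\<epsilon>>0. \<exists>K. \<forall>k\<ge>K. v k \<noteq> 0 \<longrightarrow> \<bar>\<alpha> k - 1\<bar> < \<epsilon>) \<and>
         (\<lambda>k. norm (grad \<phi> (x k))) \<longlonglongrightarrow> 0 \<and>
         (\<exists>C K. \<forall>k>K. norm (grad \<phi> (x (Suc k))) \<le> C * (norm (grad \<phi> (x k)))\<^sup>2)"
proof -
  define F where "F = penalty \<omega> f c"
  define B where "B = regularizer_grad \<rho> \<tau> S"
  define D where "D y u = penalty_hessian \<omega> f c y *v u" for y u
  have Ssym: "transpose S = S" and Spsd: "0 \<le> u \<bullet> (S *v u)" for u
    using S by (cases "u = 0"; auto simp: sym_pos_def_def less_imp_le)+
  obtain K where K: "0 \<le> K"
    and F_taylor: "\<And>z y. z \<in> Omega \<Longrightarrow> y \<in> Omega \<Longrightarrow>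
      norm (grad F z - grad F y - D y (z - y)) \<le> K * (norm (z - y))\<^sup>2"
    and Dbound: "\<And>y u. y \<in> Omega \<Longrightarrow> norm (D y u) \<le> K * norm u"
    by (rule penalty_estimates[OF pos(2) f(2) c(2) bounded_Omega convex_Omega, folded F_def D_def])
       (rule that)
  have diff: "f differentiable at y" "c differentiable at y" for y
    using f(2) c(2) by (auto simp: twice_lipschitz_differentiable_def differentiable_def)
  then have Fdiff: "F differentiable at y" for y
    using penalty_has_derivative unfolding F_def differentiable_def by blast
  have \<phi>_der: "(\<phi> has_derivative (\<lambda>h. (grad F y + B y) \<bullet> h)) (at y)" if "y \<in> Omega" for y
    unfolding \<phi>_def F_def B_def
    by (rule penalty_barrier_has_derivative[OF Ssym that Fdiff[unfolded F_def]])
  have hess: "sym_pos_semidef (penalty_hessian \<omega> f c (x k))" for k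
    using exact_suitable[of k] by (simp add: suitable_def penalty_hessian_def)
  then have hsym: "transpose (penalty_hessian \<omega> f c (x k)) = penalty_hessian \<omega> f c (x k)" for k
    by (simp add: sym_pos_semidef_def)

  have xSuc: "x (Suc k) = x k + \<alpha> k *\<^sub>R v k"
    and search: "is_arg_min (\<lambda>a. \<phi> (x k + a *\<^sub>R v k)) (\<lambda>a. 0 \<le> a \<and> x k + a *\<^sub>R v k \<in> Omega) (\<alpha> k)"
    and sub: "is_arg_min (subproblem \<rho> \<omega> \<tau> S f c (x k) (lagrangian_hessian \<omega> f c (x k)))
        (\<lambda>y. y \<in> Omega) (x k + v k)" for k
    using run unfolding ppd_ipm_def \<phi>_def exact_chosen by (auto simp: algebra_simps)
  have x_in: "x k \<in> Omega" for k
  proof (cases k)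
    case 0
    then show ?thesis using run by (simp add: ppd_ipm_def)
  next
    case (Suc j)
    then show ?thesis using search[of j] xSuc[of j] by (simp add: is_arg_min_def)
  qed
  have z_in: "x k + v k \<in> Omega" for k
    using sub[of k] by (simp add: is_arg_min_def)

  interpret split_newton "grad F" B D Omega x v \<alpha> "\<tau> / 2" K
  proof
    show "\<tau> / 2 * (norm (z - y))\<^sup>2 \<le> (B z - B y) \<bullet> (z - y)" if "y \<in> Omega" "z \<in> Omega" for y z
      unfolding B_def using that pos Spsd
      by (intro regularizer_grad_strongly_monotone) auto
    show "0 \<le> u \<bullet> D (x k) u" for k u
      using hess[of k] by (simp add: D_def sym_pos_semidef_def)
    show "grad F (x k) + D (x k) (v k) + B (x k + v k) = 0" for k
    proof -
      let ?q = "subproblem \<rho> \<omega> \<tau> S f c (x k) (lagrangian_hessian \<omega> f c (x k))"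
      let ?g = "grad F (x k) + D (x k) (v k) + B (x k + v k)"
      have "(?q has_derivative (\<lambda>h. ?g \<bullet> h)) (at (x k + v k))"
        using subproblem_has_derivative[OF Ssym z_in[of k] hsym[of k] diff, of \<rho> \<tau>]
        by (simp add: F_def D_def B_def)
      moreover have "\<forall>y\<in>Omega. ?q (x k + v k) \<le> ?q y"
        using sub[of k] by (auto simp: is_arg_min_linorder)
      ultimately have "(\<lambda>h. ?g \<bullet> h) = (\<lambda>h. 0)"
        using differential_zero_maxmin[OF z_in open_Omega] by blast
      then have "?g \<bullet> ?g = 0" by metis
      then show ?thesis by simp
    qed
  qed (use pos K F_taylor x_in z_in xSuc in auto)

  have grad_\<phi>: "grad \<phi> y = G y" if "y \<in> Omega" for y
    unfolding G_def by (rule grad_eqI[OF \<phi>_der[OF that]])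
  \<comment> \<open>A vanishing step size contradicts the descent property unless the direction vanishes.\<close>
  have line: "G (x (Suc k)) \<bullet> v k = 0" for k
  proof -
    have der: "(\<phi> has_derivative (\<lambda>h. G (x k + \<alpha> k *\<^sub>R v k) \<bullet> h)) (at (x k + \<alpha> k *\<^sub>R v k))"
      unfolding G_def using x_in[of "Suc k"] by (intro \<phi>_der) (simp add: xSuc)
    note opt = exact_line_search[OF open_Omega der search]
    show ?thesis
    proof (cases "\<alpha> k > 0")
      case False
      then have "\<alpha> k = 0"
        using search[of k] by (auto simp: is_arg_min_def)
      then have "\<tau> / 2 * (norm (v k))\<^sup>2 \<le> 0"
        using descent[of k] opt(1) by simp
      then have "v k = 0"
        using pos(3) by (auto simp: mult_le_0_iff)
      then show ?thesis by simp
    qed (use opt(2) xSuc in simp)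
  qed
  obtain \<delta>1 L where "\<delta>1 > 0" "0 \<le> L"
    and Blip: "\<And>y z. y \<in> ball xstar \<delta>1 \<Longrightarrow> z \<in> ball xstar \<delta>1 \<Longrightarrow> norm (B y - B z) \<le> L * norm (y - z)"
    by (rule regularizer_grad_locally_lipschitz[OF global_convergence(1), of \<rho> \<tau> S, folded B_def])
       (rule that)
  obtain \<delta>2 where \<delta>2: "\<delta>2 > 0" "ball xstar \<delta>2 \<subseteq> Omega"
    using open_Omega global_convergence(1) open_contains_ball by blast
  define \<delta> where "\<delta> = Min {\<delta>1, \<delta>2, 1}"
  have \<delta>: "\<delta> > 0" "\<delta> \<le> \<delta>1" "\<delta> \<le> \<delta>2" "\<delta> \<le> 1"
    using \<open>\<delta>1 > 0\<close> \<open>\<delta>2 > 0\<close> by (auto simp: \<delta>_def)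
  \<comment> \<open>Radius at most 1 keeps \<open>norm (y - z) \<le> 2\<close>, so the quadratic remainder is absorbed linearly.\<close>
  have Glip: "norm (G y - G z) \<le> (3 * K + L) * norm (y - z)"
    if yz: "y \<in> ball xstar \<delta>" "z \<in> ball xstar \<delta>" for y z
  proof -
    have O: "y \<in> Omega" "z \<in> Omega" using yz \<delta> \<delta>2 by (auto simp: subset_iff)
    have "norm (y - z) \<le> dist xstar y + dist xstar z"
      using dist_triangle2[of y z xstar] by (simp add: dist_norm norm_minus_commute)
    then have "norm (y - z) \<le> 2" using yz \<delta>(4) by auto
    then have "K * (norm (y - z))\<^sup>2 \<le> K * (2 * norm (y - z))"
      using K unfolding power2_eq_square by (intro mult_left_mono mult_right_mono) auto
    moreover have "norm (B y - B z) \<le> L * norm (y - z)"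
      using yz \<delta> by (intro Blip) auto
    moreover have "norm (G y - G z) \<le> norm (grad F y - grad F z - D z (y - z)) + norm (D z (y - z)) + norm (B y - B z)"
      unfolding G_def by norm
    ultimately show ?thesis
      using taylor[OF O(2,1)] Dbound[OF O(2), of "y - z"] by (simp add: algebra_simps)
  qed
  have "G xstar = 0" using global_convergence grad_\<phi> by auto
  have "0 \<le> 3 * K + L" using K \<open>0 \<le> L\<close> by simp
  note conv = quadratic_convergence[OF global_convergence(3) \<open>G xstar = 0\<close> \<delta>(1) this Glip line]
  have "\<exists>C. \<forall>k. \<alpha> k = 1 \<longrightarrow> norm (grad \<phi> (x k + \<alpha> k *\<^sub>R v k)) \<le> C * (norm (v k))\<^sup>2"
    using full_step_residual z_in grad_\<phi> by (intro exI[of _ K]) simp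
  moreover have "\<forall>\<epsilon>>0. \<exists>N. \<forall>k\<ge>N. v k \<noteq> 0 \<longrightarrow> \<bar>\<alpha> k - 1\<bar> < \<epsilon>"
    using conv(2) by (simp add: eventually_sequentially)
  moreover have "(\<lambda>k. norm (grad \<phi> (x k))) \<longlonglongrightarrow> 0"
    using conv(1) by (simp add: grad_\<phi> x_in)
  moreover have "\<exists>C N. \<forall>k>N. norm (grad \<phi> (x (Suc k))) \<le> C * (norm (grad \<phi> (x k)))\<^sup>2"
    using conv(3) unfolding eventually_sequentially grad_\<phi>[OF x_in] by (meson less_imp_le)
  ultimately show ?thesis by blast
qed

end
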